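(* Let $D$ be an integral domain that is not a field, let $*$ be $d$ or $t$, and let $P$ be a property defining a non-empty subset $\Gamma$ of $f_*(D)$ such that $f_*(D)\vartriangleleft^t P$. If $D$ satisfies Conrad's twisted condition $(F^t)$, then every $I\in f_*(D)$ is contained in at most a finite number of maximal $*$-ideals. Conversely, if $D$ is of finite $*$-character, then $D$ satisfies $(F^t)$.
   Context: Let $K$ be the quotient field of $D$. For a nonzero fractional ideal $I$ of $D$: $I^{-1}=\{x\in K: xI\subseteq D\}$, $I_v=(I^{-1})^{-1}$, $I_t=\bigcup\{J_v: J\subseteq I \text{ a nonzero finitely generated ideal}\}$, and $I_d=I$. Write $I^*$ for $I_d=I$ if $*=d$ and for $I_t$ if $*=t$. $I$ is a $*$-ideal if $I^*=I$, and is of finite type if $I=J^*$ for some nonzero finitely generated $J$. A maximal $*$-ideal is an ideal maximal among proper integral $*$-ideals. $f_d(D)$ is the set of proper nonzero finitely generated ideals of $D$, and $f_t(D)$ is the set of proper (integral, nonzero) $t$-ideals of finite type of $D$. $f_*(D)\vartriangleleft^t P$ means: for every $I\in f_*(D)$ there are a positive integer $n=n(I)$ and $\gamma\in\Gamma$ with $I^n\subseteq\gamma$. For $I\in f_*(D)$, $Span(I)$ is the set of all $\gamma\in\Gamma$ such that $I^n\subseteq\gamma$ for some positive integer $n$. Two ideals $A,B$ are $*$-comaximal if $(A+B)^*=D$. $D$ satisfies Conrad's twisted condition $(F^t)$ if for each $I\in f_*(D)$, $Span(I)$ does not contain an infinite sequence of mutually $*$-comaximal members. $D$ is of finite $*$-character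 if every nonzero non-unit of $D$ belongs to only finitely many maximal $*$-ideals. *)

theory Defs
  imports "HOL-Computational_Algebra.Polynomial_Factorial"
begin

text \<open>
  The domain \<open>D\<close> is a type \<open>'a :: idom\<close> and \<open>K\<close> is its quotient field \<open>'a fract\<close>. All ideals,
  fractional or integral, are represented as subsets of \<open>K\<close>; the copy of \<open>D\<close> inside \<open>K\<close> is
  \<open>base_ring\<close>.
\<close>

definition base_ring :: "'a::idom fract set" where
  "base_ring = range to_fract"

definition fscale :: "'a::idom \<Rightarrow> 'a fract \<Rightarrow> 'a fract" where
  "fscale a x = to_fract a * x"

interpretation fmod: module "fscale :: 'a::idom \<Rightarrow> 'a fract \<Rightarrow> 'a fract"
  by standard (simp_all add: fscale_def algebra_simps)

definition fractional_ideal :: "'a::idom fract set \<Rightarrow> bool" where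
  "fractional_ideal I \<longleftrightarrow>
     fmod.subspace I \<and> (\<exists>d. d \<noteq> 0 \<and> fscale d ` I \<subseteq> base_ring)"

definition nonzero_frac_ideal :: "'a::idom fract set \<Rightarrow> bool" where
  "nonzero_frac_ideal I \<longleftrightarrow> fractional_ideal I \<and> I \<noteq> {0}"

definition fin_gen :: "'a::idom fract set \<Rightarrow> bool" where
  "fin_gen J \<longleftrightarrow> (\<exists>S. finite S \<and> J = fmod.span S)"

definition ideal_inv :: "'a::idom fract set \<Rightarrow> 'a fract set" where
  "ideal_inv I = {x. \<forall>y\<in>I. x * y \<in> base_ring}"

definition v_closure :: "'a::idom fract set \<Rightarrow> 'a fract set" where
  "v_closure I = ideal_inv (ideal_inv I)"

definition t_closure :: "'a::idom fract set \<Rightarrow> 'a fract set" where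
  "t_closure I = \<Union>{v_closure J |J. nonzero_frac_ideal J \<and> fin_gen J \<and> J \<subseteq> I}"

datatype star_op = Star_d | Star_t

fun star :: "star_op \<Rightarrow> 'a::idom fract set \<Rightarrow> 'a fract set" where
  "star Star_d I = I"
| "star Star_t I = t_closure I"

definition star_ideal :: "star_op \<Rightarrow> 'a::idom fract set \<Rightarrow> bool" where
  "star_ideal s I \<longleftrightarrow> nonzero_frac_ideal I \<and> star s I = I"

definition finite_type :: "star_op \<Rightarrow> 'a::idom fract set \<Rightarrow> bool" where
  "finite_type s I \<longleftrightarrow> (\<exists>J. nonzero_frac_ideal J \<and> fin_gen J \<and> I = star s J)"

definition proper_integral_star_ideal :: "star_op \<Rightarrow> 'a::idom fract set \<Rightarrow> bool" where
  "proper_integral_star_ideal s I \<longleftrightarrow> star_ideal s I \<and> I \<subset> base_ring"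

definition maximal_star_ideal :: "star_op \<Rightarrow> 'a::idom fract set \<Rightarrow> bool" where
  "maximal_star_ideal s M \<longleftrightarrow> proper_integral_star_ideal s M \<and>
     (\<forall>N. proper_integral_star_ideal s N \<longrightarrow> M \<subseteq> N \<longrightarrow> N = M)"

text \<open>\<open>f_star s\<close> is the set $f_*(D)$.\<close>

fun f_star :: "star_op \<Rightarrow> 'a::idom fract set set" where
  "f_star Star_d = {I. nonzero_frac_ideal I \<and> I \<subset> base_ring \<and> fin_gen I}"
| "f_star Star_t = {I. proper_integral_star_ideal Star_t I \<and> finite_type Star_t I}"

definition ideal_sum :: "'a::idom fract set \<Rightarrow> 'a fract set \<Rightarrow> 'a fract set" where
  "ideal_sum A B = {a + b |a b. a \<in> A \<and> b \<in> B}"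

definition ideal_prod :: "'a::idom fract set \<Rightarrow> 'a fract set \<Rightarrow> 'a fract set" where
  "ideal_prod A B = fmod.span {a * b |a b. a \<in> A \<and> b \<in> B}"

primrec ideal_pow :: "'a::idom fract set \<Rightarrow> nat \<Rightarrow> 'a fract set" where
  "ideal_pow I 0 = base_ring"
| "ideal_pow I (Suc n) = ideal_prod I (ideal_pow I n)"

text \<open>
  In the following, \<open>P\<close> is the property and \<open>Gamma_set s P\<close> is the subset \<open>\<Gamma>\<close> of $f_*(D)$ that it
  defines; \<open>twisted_lhd s P\<close> is the relation $f_*(D) \vartriangleleft^t P$.
\<close>

definition Gamma_set :: "star_op \<Rightarrow> ('a::idom fract set \<Rightarrow> bool) \<Rightarrow> 'a fract set set" where
  "Gamma_set s P = {I \<in> f_star s. P I}"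

definition twisted_lhd :: "star_op \<Rightarrow> ('a::idom fract set \<Rightarrow> bool) \<Rightarrow> bool" where
  "twisted_lhd s P \<longleftrightarrow> (\<forall>I\<in>f_star s. \<exists>n>0. \<exists>\<gamma>\<in>Gamma_set s P. ideal_pow I n \<subseteq> \<gamma>)"

definition Span :: "star_op \<Rightarrow> ('a::idom fract set \<Rightarrow> bool) \<Rightarrow> 'a fract set \<Rightarrow> 'a fract set set" where
  "Span s P I = {\<gamma> \<in> Gamma_set s P. \<exists>n>0. ideal_pow I n \<subseteq> \<gamma>}"

definition star_comaximal :: "star_op \<Rightarrow> 'a::idom fract set \<Rightarrow> 'a fract set \<Rightarrow> bool" where
  "star_comaximal s A B \<longleftrightarrow> star s (ideal_sum A B) = base_ring"

definition conrad_twisted :: "star_op \<Rightarrow> ('a::idom fract set \<Rightarrow> bool) \<Rightarrow> bool" where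
  "conrad_twisted s P \<longleftrightarrow> (\<forall>I\<in>f_star s.
     \<not> (\<exists>\<gamma> :: nat \<Rightarrow> 'a fract set. (\<forall>i. \<gamma> i \<in> Span s P I) \<and>
          (\<forall>i j. i \<noteq> j \<longrightarrow> star_comaximal s (\<gamma> i) (\<gamma> j))))"

text \<open>
  Finite \<open>*\<close>-character is a property of the domain alone, so the type of \<open>D\<close> is passed as an
  explicit argument.
\<close>

definition finite_star_character :: "star_op \<Rightarrow> 'a::idom itself \<Rightarrow> bool" where
  "finite_star_character s D \<longleftrightarrow> (\<forall>x::'a. x \<noteq> 0 \<longrightarrow> \<not> x dvd 1 \<longrightarrow>
     finite {M. maximal_star_ideal s M \<and> to_fract x \<in> M})"

end

theory Submission
  imports Defs
begin

text \<open>
  Maximal \<open>*\<close>-ideals exist above every proper \<open>*\<close>-ideal and are prime, and two proper \<open>*\<close>-ideals are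
  \<open>*\<close>-comaximal iff no maximal \<open>*\<close>-ideal contains both. Hence, if \<open>D\<close> satisfies the twisted condition,
  then there is no infinite sequence of mutually \<open>*\<close>-comaximal members of $f_*(D)$ above \<open>I\<close>: powers
  of its terms would lie in comaximal members of \<open>\<Gamma>\<close>. If some member of $f_*(D)$ were not contained
  in any \<open>H\<close> lying in exactly one maximal \<open>*\<close>-ideal, splitting it repeatedly into comaximal
  pairs would give such a sequence. So there are such \<open>H\<close> above every member of $f_*(D)$; the maximal
  ideals of those above \<open>I\<close> are finitely many, again by comaximality, and they exhaust the maximal
  \<open>*\<close>-ideals containing \<open>I\<close>: given another one \<open>M\<close>, enlarge \<open>I\<close> by finitely many elements of \<open>M\<close>
  that avoid all of them. The converse holds because comaximal ideals lie in distinct maximal ideals.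
\<close>

section \<open>Submodules of the quotient field and fractional ideals\<close>

lemma base_ring_closed:
  "0 \<in> base_ring" "1 \<in> base_ring" "to_fract a \<in> base_ring"
  "x \<in> base_ring \<Longrightarrow> y \<in> base_ring \<Longrightarrow> x + y \<in> base_ring"
  "x \<in> base_ring \<Longrightarrow> y \<in> base_ring \<Longrightarrow> x * y \<in> base_ring"
  unfolding base_ring_def
  by (auto simp flip: to_fract_0 to_fract_1 to_fract_add to_fract_mult)

lemma subspaceI:
  assumes "0 \<in> I" "\<And>x y. x \<in> I \<Longrightarrow> y \<in> I \<Longrightarrow> x + y \<in> I"
    and "\<And>r x. r \<in> base_ring \<Longrightarrow> x \<in> I \<Longrightarrow> r * x \<in> I"
  shows "fmod.subspace I"
  using assms by (simp add: fmod.subspace_def fscale_def base_ring_closed)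

lemma subspace_mult:
  assumes "fmod.subspace I" "r \<in> base_ring" "x \<in> I"
  shows "r * x \<in> I"
  using assms fmod.subspace_scale[of I x] by (auto simp: fscale_def base_ring_def)

lemma subspace_base_ring: "fmod.subspace base_ring"
  by (intro subspaceI base_ring_closed)

lemma span_subset_base_ring: "S \<subseteq> base_ring \<Longrightarrow> fmod.span S \<subseteq> base_ring"
  by (simp add: fmod.span_minimal subspace_base_ring)

lemma subspace_eq_base_ring:
  assumes "fmod.subspace I" "I \<subseteq> base_ring" "1 \<in> I"
  shows "I = base_ring"
  using assms subspace_mult[of I _ 1] by auto

lemma span_nonzero: "\<not> S \<subseteq> {0} \<Longrightarrow> fmod.span S \<noteq> {0}"
  using fmod.span_superset by blast

lemma nonzero_frac_ideal_mono:
  assumes "nonzero_frac_ideal I" "fmod.subspace J" "J \<subseteq> I" "J \<noteq> {0}"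
  shows "nonzero_frac_ideal J"
  using assms unfolding nonzero_frac_ideal_def fractional_ideal_def by blast

lemma nonzero_frac_ideal_integral:
  assumes "fmod.subspace I" "I \<subseteq> base_ring" "I \<noteq> {0}"
  shows "nonzero_frac_ideal I"
proof -
  \<comment> \<open>An integral ideal has the common denominator 1.\<close>
  have "fscale 1 ` I \<subseteq> base_ring"
    using assms(2) by (auto simp: fscale_def)
  then show ?thesis
    using assms unfolding nonzero_frac_ideal_def fractional_ideal_def by (metis zero_neq_one)
qed

lemma nonzero_frac_idealD:
  assumes "nonzero_frac_ideal I"
  shows "fmod.subspace I" "\<not> I \<subseteq> {0}"
  using assms fmod.subspace_0 unfolding nonzero_frac_ideal_def fractional_ideal_def by blast+

section \<open>Inverses and the v-closure\<close>

lemma subspace_ideal_inv: "fmod.subspace (ideal_inv I)"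
  by (rule subspaceI) (auto simp: ideal_inv_def base_ring_closed distrib_right mult.assoc)

lemma ideal_inv_antimono: "I \<subseteq> J \<Longrightarrow> ideal_inv J \<subseteq> ideal_inv I"
  by (auto simp: ideal_inv_def)

lemma v_closure_superset: "I \<subseteq> v_closure I"
  by (auto simp: ideal_inv_def v_closure_def mult.commute)

lemma v_closure_mono: "I \<subseteq> J \<Longrightarrow> v_closure I \<subseteq> v_closure J"
  by (simp add: v_closure_def ideal_inv_antimono)

text \<open>Since \<open>ideal_inv\<close> reverses inclusions, applying it to the inclusion of
  \<open>ideal_inv I\<close> in its own v-closure gives the inclusion that does not come from
  \<open>v_closure_superset\<close>.\<close>

lemma v_closure_idem: "v_closure (v_closure I) = v_closure I"
proof -
  have "v_closure (v_closure I) \<subseteq> v_closure I"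
    unfolding v_closure_def
    by (intro ideal_inv_antimono v_closure_superset[unfolded v_closure_def])
  then show ?thesis
    using v_closure_superset by blast
qed

lemma subspace_v_closure: "fmod.subspace (v_closure I)"
  by (simp add: v_closure_def subspace_ideal_inv)

lemma v_closure_base_ring: "v_closure base_ring = base_ring"
proof -
  have "ideal_inv base_ring = (base_ring :: 'a fract set)"
    using base_ring_closed by (force simp: ideal_inv_def)
  then show ?thesis by (simp add: v_closure_def)
qed

text \<open>If \<open>z\<close> multiplies y I into D, then \<open>z * y\<close> lies in the inverse
  of \<open>I\<close>, so \<open>x\<close> multiplies it into D.\<close>

lemma v_closure_mult:
  assumes "x \<in> v_closure I"
  shows "y * x \<in> v_closure ((*) y ` I)"
proof -
  have "z * y * x \<in> base_ring" if "z \<in> ideal_inv ((*) y ` I)" for z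
  proof -
    have "z * y \<in> ideal_inv I"
      using that by (simp add: ideal_inv_def mult.assoc)
    then show ?thesis
      using assms by (auto simp: v_closure_def ideal_inv_def[of "ideal_inv I"] mult.commute[of x])
  qed
  then show ?thesis
    by (auto simp: v_closure_def ideal_inv_def[of "ideal_inv _"] mult_ac)
qed

lemma subset_v_closure_span: "S \<subseteq> v_closure (fmod.span S)"
  using fmod.span_superset v_closure_superset by (rule order_trans)

text \<open>The preimage of the right-hand span under multiplication by \<open>y\<close> is a
  submodule containing \<open>S\<close>.\<close>

lemma span_mult_image: "(*) y ` fmod.span S \<subseteq> fmod.span ((*) y ` S)"
proof -
  have "fmod.subspace {x. y * x \<in> fmod.span ((*) y ` S)}"
    by (rule subspaceI)
      (auto simp: fmod.span_zero distrib_left fmod.span_add mult.left_commute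
        intro: subspace_mult[OF fmod.subspace_span])
  moreover have "S \<subseteq> {x. y * x \<in> fmod.span ((*) y ` S)}"
    by (auto intro: fmod.span_base)
  ultimately show ?thesis
    using fmod.span_minimal by blast
qed

section \<open>The t-closure through finite generating sets\<close>

text \<open>This and the next lemma trade the finitely generated ideals in \<open>t_closure\<close>
  for finite generating sets; \<open>\<not> S \<subseteq> {0}\<close> ensures that the span is
  nonzero.\<close>

lemma t_closure_memI:
  assumes "nonzero_frac_ideal I" "finite S" "S \<subseteq> I" "\<not> S \<subseteq> {0}"
    "x \<in> v_closure (fmod.span S)"
  shows "x \<in> t_closure I"
proof -
  have "fmod.span S \<subseteq> I"
    using assms by (simp add: fmod.span_minimal nonzero_frac_idealD)
  moreover from this have "nonzero_frac_ideal (fmod.span S)"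
    by (intro nonzero_frac_ideal_mono[OF assms(1)] span_nonzero[OF assms(4)] fmod.subspace_span)
  moreover have "fin_gen (fmod.span S)"
    using assms(2) unfolding fin_gen_def by blast
  ultimately show ?thesis
    unfolding t_closure_def using assms(5) by blast
qed

lemma t_closure_memE:
  assumes "x \<in> t_closure I"
  obtains S where "finite S" "S \<subseteq> I" "\<not> S \<subseteq> {0}" "x \<in> v_closure (fmod.span S)"
proof -
  obtain S where S: "nonzero_frac_ideal (fmod.span S)" "finite S" "fmod.span S \<subseteq> I"
    "x \<in> v_closure (fmod.span S)"
    using assms unfolding t_closure_def fin_gen_def by blast
  have "\<not> S \<subseteq> {0}"
    using nonzero_frac_idealD(2)[OF S(1)] fmod.span_minimal[OF _ fmod.subspace_single_0]
    by metis
  moreover have "S \<subseteq> I"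
    using S(3) fmod.span_superset by (metis order_trans)
  ultimately show thesis
    using that S(2,4) by metis
qed

lemma t_closure_mono: "I \<subseteq> J \<Longrightarrow> t_closure I \<subseteq> t_closure J"
  unfolding t_closure_def by blast

text \<open>The union defining the t-closure is directed: joining two finite generating sets
  dominates both v-closures.\<close>

lemma t_closure_finite_subset:
  assumes "nonzero_frac_ideal I" "finite T" "T \<subseteq> t_closure I"
  shows "\<exists>S. finite S \<and> S \<subseteq> I \<and> \<not> S \<subseteq> {0} \<and> T \<subseteq> v_closure (fmod.span S)"
  using assms(2,3)
proof (induction T)
  case empty
  \<comment> \<open>Even for empty \<open>T\<close> the generating set must span a nonzero
    ideal.\<close>
  obtain z where "z \<in> I" "z \<noteq> 0"
    using nonzero_frac_idealD(2)[OF assms(1)] by blast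
  then show ?case
    by (intro exI[of _ "{z}"]) auto
next
  case (insert x T)
  have "T \<subseteq> t_closure I"
    using insert.prems by simp
  from insert.IH[OF this] obtain S
    where S: "finite S" "S \<subseteq> I" "\<not> S \<subseteq> {0}" "T \<subseteq> v_closure (fmod.span S)"
    by (elim exE conjE)
  have "x \<in> t_closure I"
    using insert.prems by simp
  then obtain S' where S': "finite S'" "S' \<subseteq> I" "x \<in> v_closure (fmod.span S')"
    by (rule t_closure_memE)
  have "v_closure (fmod.span S) \<subseteq> v_closure (fmod.span (S \<union> S'))"
    "v_closure (fmod.span S') \<subseteq> v_closure (fmod.span (S \<union> S'))"
    by (intro v_closure_mono fmod.span_mono Un_upper1 Un_upper2)+
  then have "insert x T \<subseteq> v_closure (fmod.span (S \<union> S'))"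
    using S(4) S'(3) by blast
  then show ?case
    using S(1-3) S'(1,2) by (intro exI[of _ "S \<union> S'"]) simp
qed

section \<open>Closure properties common to d and t\<close>

lemma star_mono: "I \<subseteq> J \<Longrightarrow> star s I \<subseteq> star s J"
  by (cases s) (simp_all add: t_closure_mono)

lemma star_superset:
  assumes "nonzero_frac_ideal I"
  shows "I \<subseteq> star s I"
proof (cases s)
  case Star_t
  have "x \<in> t_closure I" if "x \<in> I" for x
  proof -
    \<comment> \<open>Adjoining \<open>z\<close> keeps the generating set nonzero when
      \<open>x\<close> is 0.\<close>
    obtain z where "z \<in> I" "z \<noteq> 0"
      using nonzero_frac_idealD(2)[OF assms] by blast
    moreover have "x \<in> v_closure (fmod.span {x, z})"
      using subset_v_closure_span by blast
    ultimately show ?thesis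
      using that by (intro t_closure_memI[OF assms, of "{x, z}"]) auto
  qed
  then show ?thesis using Star_t by auto
qed simp

lemma subspace_star:
  assumes "nonzero_frac_ideal I"
  shows "fmod.subspace (star s I)"
proof (cases s)
  case Star_d
  then show ?thesis using assms by (simp add: nonzero_frac_idealD)
next
  case Star_t
  have "fmod.subspace (t_closure I)"
  proof (rule subspaceI)
    show "0 \<in> t_closure I"
      using star_superset[OF assms, of Star_t] nonzero_frac_idealD(1)[OF assms]
        fmod.subspace_0 by auto
  next
    fix x y assume "x \<in> t_closure I" "y \<in> t_closure I"
    then obtain S where "finite S" "S \<subseteq> I" "\<not> S \<subseteq> {0}" "{x, y} \<subseteq> v_closure (fmod.span S)"
      using t_closure_finite_subset[OF assms, of "{x, y}"] by auto
    then show "x + y \<in> t_closure I"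
      by (intro t_closure_memI[OF assms, of S])
        (auto intro: fmod.subspace_add subspace_v_closure)
  next
    fix r x :: "'a fract" assume "r \<in> base_ring" "x \<in> t_closure I"
    from this(2) obtain S where "finite S" "S \<subseteq> I" "\<not> S \<subseteq> {0}" "x \<in> v_closure (fmod.span S)"
      by (rule t_closure_memE)
    then show "r * x \<in> t_closure I"
      using \<open>r \<in> base_ring\<close> by (intro t_closure_memI[OF assms, of S])
        (auto intro: subspace_mult subspace_v_closure)
  qed
  then show ?thesis using Star_t by simp
qed

lemma star_subset_base_ring:
  assumes "I \<subseteq> base_ring"
  shows "star s I \<subseteq> base_ring"
proof (cases s)
  case Star_t
  have "v_closure J \<subseteq> base_ring" if "J \<subseteq> I" for J
    using that assms v_closure_mono v_closure_base_ring by blast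
  then show ?thesis using Star_t by (auto simp: t_closure_def)
qed (use assms in simp)

text \<open>For t, finitely many elements of the closure lie in a single v-closure, and the
  v-closure is idempotent.\<close>

lemma star_idem:
  assumes "nonzero_frac_ideal I"
  shows "star s (star s I) \<subseteq> star s I"
proof (cases s)
  case Star_t
  have "t_closure (t_closure I) \<subseteq> t_closure I"
  proof
    fix x assume "x \<in> t_closure (t_closure I)"
    then obtain T where T: "finite T" "T \<subseteq> t_closure I" "x \<in> v_closure (fmod.span T)"
      by (rule t_closure_memE)
    obtain S where S: "finite S" "S \<subseteq> I" "\<not> S \<subseteq> {0}" "T \<subseteq> v_closure (fmod.span S)"
      using t_closure_finite_subset[OF assms T(1,2)] by blast
    have "fmod.span T \<subseteq> v_closure (fmod.span S)"
      using S(4) subspace_v_closure by (rule fmod.span_minimal)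
    then have "v_closure (fmod.span T) \<subseteq> v_closure (fmod.span S)"
      using v_closure_mono v_closure_idem by metis
    then show "x \<in> t_closure I"
      using T(3) by (intro t_closure_memI[OF assms S(1-3)]) blast
  qed
  then show ?thesis using Star_t by simp
qed simp

text \<open>This is the finite character of the closure. It makes unions of chains closed and lets
  comaximality be witnessed by finitely many elements.\<close>

lemma star_finite_subset:
  assumes "nonzero_frac_ideal I" "x \<in> star s I"
  shows "\<exists>S. finite S \<and> S \<subseteq> I \<and> x \<in> star s (fmod.span S)"
proof (cases s)
  case Star_d
  then show ?thesis
    using assms by (intro exI[of _ "{x}"]) (auto intro: fmod.span_base)
next
  case Star_t
  then have "x \<in> t_closure I"
    using assms(2) by simp
  then obtain S where S: "finite S" "S \<subseteq> I" "\<not> S \<subseteq> {0}" "x \<in> v_closure (fmod.span S)"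
    by (rule t_closure_memE)
  have "nonzero_frac_ideal (fmod.span S)"
    using fmod.span_minimal[OF S(2) nonzero_frac_idealD(1)[OF assms(1)]]
    by (intro nonzero_frac_ideal_mono[OF assms(1)] span_nonzero[OF S(3)] fmod.subspace_span)
  then have "x \<in> t_closure (fmod.span S)"
    using t_closure_memI[OF _ S(1) fmod.span_superset S(3,4)] by blast
  then show ?thesis
    using S Star_t by auto
qed

text \<open>A weak form of the identity between y I^* and the closure of y I, shaped for the
  primality proof. With \<open>y \<noteq> 0\<close>, multiplication by \<open>y\<close> keeps
  generating sets nonzero.\<close>

lemma star_mult:
  assumes "nonzero_frac_ideal I" "y \<noteq> 0" "x \<in> star s I" "(*) y ` I \<subseteq> M" "nonzero_frac_ideal M"
  shows "y * x \<in> star s M"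
proof (cases s)
  case Star_d
  then show ?thesis using assms by auto
next
  case Star_t
  then have "x \<in> t_closure I"
    using assms(3) by simp
  then obtain S where S: "finite S" "S \<subseteq> I" "\<not> S \<subseteq> {0}" "x \<in> v_closure (fmod.span S)"
    by (rule t_closure_memE)
  have "y * x \<in> v_closure (fmod.span ((*) y ` S))"
    using v_closure_mult[OF S(4)] v_closure_mono[OF span_mult_image] by blast
  then have "y * x \<in> t_closure M"
    using S assms by (intro t_closure_memI[of _ "(*) y ` S"]) auto
  then show ?thesis using Star_t by simp
qed

section \<open>Proper and maximal *-ideals\<close>

lemma proper_integral_star_idealD:
  assumes "proper_integral_star_ideal s M"
  shows "nonzero_frac_ideal M" "fmod.subspace M" "M \<subseteq> base_ring" "1 \<notin> M" "star s M = M"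
    "\<not> M \<subseteq> {0}"
  using assms subspace_eq_base_ring[of M] nonzero_frac_idealD[of M]
  unfolding proper_integral_star_ideal_def star_ideal_def by auto

text \<open>Provides a dichotomy: the closure of a nonzero integral ideal contains 1 or is itself a
  proper *-ideal, so that \<open>ex_maximal_star_ideal\<close> applies.\<close>

lemma proper_integral_star_ideal_star:
  assumes "fmod.subspace I" "I \<subseteq> base_ring" "I \<noteq> {0}" "1 \<notin> star s I"
  shows "proper_integral_star_ideal s (star s I)"
proof -
  have I: "nonzero_frac_ideal I"
    using assms nonzero_frac_ideal_integral by blast
  have sub: "star s I \<subseteq> base_ring"
    using assms star_subset_base_ring by blast
  have "star s I \<noteq> {0}"
    using star_superset[OF I] nonzero_frac_idealD(2)[OF I] by blast
  then have nz: "nonzero_frac_ideal (star s I)"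
    using subspace_star[OF I] sub nonzero_frac_ideal_integral by blast
  have "star s (star s I) = star s I"
    using star_idem[OF I] star_superset[OF nz] by blast
  then show ?thesis
    using nz sub assms(4) base_ring_closed(2)
    unfolding proper_integral_star_ideal_def star_ideal_def by blast
qed

lemma maximal_star_idealD:
  assumes "maximal_star_ideal s M"
  shows "proper_integral_star_ideal s M"
    "proper_integral_star_ideal s N \<Longrightarrow> M \<subseteq> N \<Longrightarrow> N = M"
  using assms unfolding maximal_star_ideal_def by auto

text \<open>By finite character an element of the closure depends on finitely many elements of the
  union, and these lie in one member of the chain.\<close>

lemma proper_integral_star_ideal_Union_chain:
  assumes "C \<noteq> {}" and C: "\<And>N. N \<in> C \<Longrightarrow> proper_integral_star_ideal s N"
    and chain: "subset.chain UNIV C"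
  shows "proper_integral_star_ideal s (\<Union>C)"
proof -
  have fin: "\<exists>N\<in>C. S \<subseteq> N" if "finite S" "S \<subseteq> \<Union>C" for S
    using finite_subset_Union_chain[OF that assms(1) chain] by metis
  note D = proper_integral_star_idealD[OF C]
  have sub: "fmod.subspace (\<Union>C)"
  proof (rule subspaceI)
    show "0 \<in> \<Union>C"
      using assms(1) fmod.subspace_0[OF D(2)] by blast
  next
    fix x y assume "x \<in> \<Union>C" "y \<in> \<Union>C"
    then obtain N where N: "N \<in> C" "{x, y} \<subseteq> N"
      using fin[of "{x, y}"] by auto
    then have "x + y \<in> N"
      by (intro fmod.subspace_add[OF D(2)]) auto
    then show "x + y \<in> \<Union>C"
      using N(1) by blast
  next
    fix r x :: "'a fract" assume r: "r \<in> base_ring" and "x \<in> \<Union>C"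
    then obtain N where N: "N \<in> C" "x \<in> N"
      by blast
    then have "r * x \<in> N"
      by (intro subspace_mult[OF D(2) r])
    then show "r * x \<in> \<Union>C"
      using N(1) by blast
  qed
  have base: "\<Union>C \<subseteq> base_ring"
    using D(3) by blast
  have nz: "\<not> \<Union>C \<subseteq> {0}"
    using assms(1) D(6) by blast
  then have frac: "nonzero_frac_ideal (\<Union>C)"
    using sub base nonzero_frac_ideal_integral by blast
  have closed: "star s (\<Union>C) \<subseteq> \<Union>C"
  proof
    fix x assume "x \<in> star s (\<Union>C)"
    then obtain S where S: "finite S" "S \<subseteq> \<Union>C" "x \<in> star s (fmod.span S)"
      using star_finite_subset[OF frac] by blast
    obtain N where N: "N \<in> C" "S \<subseteq> N"
      using fin S by blast
    have "star s (fmod.span S) \<subseteq> star s N"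
      using N D(2) by (simp add: fmod.span_minimal star_mono)
    then show "x \<in> \<Union>C"
      using S(3) N D(5) by blast
  qed
  have "1 \<notin> star s (\<Union>C)"
    using closed D(4) by blast
  moreover have "star s (\<Union>C) = \<Union>C"
    using closed star_superset[OF frac] by blast
  ultimately show ?thesis
    using proper_integral_star_ideal_star[OF sub base, of s] nz by fastforce
qed

lemma ex_maximal_star_ideal:
  assumes "proper_integral_star_ideal s I"
  obtains M where "maximal_star_ideal s M" "I \<subseteq> M"
proof -
  let ?A = "{N. proper_integral_star_ideal s N \<and> I \<subseteq> N}"
  have "\<exists>M\<in>?A. \<forall>N\<in>?A. M \<subseteq> N \<longrightarrow> N = M"
  proof (rule subset_Zorn_nonempty)
    show "?A \<noteq> {}"
      using assms by blast
    fix C assume C: "C \<noteq> {}" "subset.chain ?A C"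
    then have "subset.chain UNIV C" "C \<subseteq> ?A"
      by (auto simp: subset.chain_def)
    then show "\<Union>C \<in> ?A"
      using C(1) proper_integral_star_ideal_Union_chain[of C s] by blast
  qed
  then obtain M where "M \<in> ?A" "\<forall>N\<in>?A. M \<subseteq> N \<longrightarrow> N = M"
    by blast
  then have "maximal_star_ideal s M" "I \<subseteq> M"
    unfolding maximal_star_ideal_def by auto
  then show thesis
    using that by blast
qed

lemma ideal_sum_subspace:
  assumes "fmod.subspace A" "fmod.subspace B"
  shows "fmod.subspace (ideal_sum A B)" "A \<subseteq> ideal_sum A B" "B \<subseteq> ideal_sum A B"
    "A \<subseteq> M \<Longrightarrow> B \<subseteq> M \<Longrightarrow> fmod.subspace M \<Longrightarrow> ideal_sum A B \<subseteq> M"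
proof -
  show "fmod.subspace (ideal_sum A B)"
  proof (rule subspaceI)
    show "0 \<in> ideal_sum A B"
      unfolding ideal_sum_def using fmod.subspace_0[OF assms(1)] fmod.subspace_0[OF assms(2)]
      by (auto intro!: exI[of _ 0])
  next
    fix x y assume "x \<in> ideal_sum A B" "y \<in> ideal_sum A B"
    then obtain a b c d where *: "x = a + b" "y = c + d" "a \<in> A" "b \<in> B" "c \<in> A" "d \<in> B"
      unfolding ideal_sum_def by auto
    then have "x + y = (a + c) + (b + d)" "a + c \<in> A" "b + d \<in> B"
      using fmod.subspace_add[OF assms(1)] fmod.subspace_add[OF assms(2)] by auto
    then show "x + y \<in> ideal_sum A B"
      unfolding ideal_sum_def by blast
  next
    fix r x :: "'a fract" assume r: "r \<in> base_ring" and "x \<in> ideal_sum A B"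
    then obtain a b where *: "x = a + b" "a \<in> A" "b \<in> B"
      unfolding ideal_sum_def by auto
    then have "r * x = r * a + r * b" "r * a \<in> A" "r * b \<in> B"
      using subspace_mult[OF assms(1) r] subspace_mult[OF assms(2) r]
      by (auto simp: distrib_left)
    then show "r * x \<in> ideal_sum A B"
      unfolding ideal_sum_def by blast
  qed
  show "A \<subseteq> ideal_sum A B" "B \<subseteq> ideal_sum A B"
    unfolding ideal_sum_def using fmod.subspace_0[OF assms(1)] fmod.subspace_0[OF assms(2)]
    by (auto, metis add.right_neutral, metis add.left_neutral)
  show "ideal_sum A B \<subseteq> M" if "A \<subseteq> M" "B \<subseteq> M" "fmod.subspace M"
    unfolding ideal_sum_def using that(1,2) fmod.subspace_add[OF that(3)] by blast
qed

text \<open>If \<open>x\<close> is outside \<open>M\<close>, maximality puts 1 into the closure of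
  the ideal generated by \<open>M\<close> and \<open>x\<close>. Multiplication by \<open>y\<close>
  sends that ideal into \<open>M\<close>, hence sends 1 into the closure of \<open>M\<close>, which
  is \<open>M\<close>.\<close>

lemma maximal_star_ideal_prime:
  assumes M: "maximal_star_ideal s M"
    and "x \<in> base_ring" "y \<in> base_ring" "x * y \<in> M"
  shows "x \<in> M \<or> y \<in> M"
proof (rule ccontr)
  assume *: "\<not> (x \<in> M \<or> y \<in> M)"
  note D = proper_integral_star_idealD[OF maximal_star_idealD(1)[OF M]]
  let ?N = "fmod.span (insert x M)"
  have sup: "insert x M \<subseteq> ?N" and sub: "?N \<subseteq> base_ring"
    using fmod.span_superset[of "insert x M"] D(3) assms(2)
      span_subset_base_ring[of "insert x M"] by blast+
  have N: "nonzero_frac_ideal ?N"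
    using sub sup D(6) by (intro nonzero_frac_ideal_integral) auto
  have "1 \<in> star s ?N"
  proof (rule ccontr)
    assume "1 \<notin> star s ?N"
    then have "proper_integral_star_ideal s (star s ?N)"
      using sub nonzero_frac_idealD(2)[OF N] by (intro proper_integral_star_ideal_star) auto
    then have "star s ?N = M"
      using sup star_superset[OF N] maximal_star_idealD(2)[OF M] by blast
    then show False
      using * sup star_superset[OF N] by blast
  qed
  moreover have "y \<noteq> 0"
    using * fmod.subspace_0[OF D(2)] by blast
  moreover have "(*) y ` ?N \<subseteq> M"
  proof -
    have "(*) y ` insert x M \<subseteq> M"
      using assms(3,4) subspace_mult[OF D(2)] by (auto simp: mult.commute[of x])
    then show ?thesis
      using fmod.span_minimal[OF _ D(2)] span_mult_image order_trans by metis
  qed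
  ultimately have "y * 1 \<in> star s M"
    by (intro star_mult[OF N _ _ _ D(1)])
  then show False
    using * D(5) by simp
qed

lemma ideal_pow_mono: "I \<subseteq> J \<Longrightarrow> ideal_pow I n \<subseteq> ideal_pow J n"
  by (induction n) (auto simp: ideal_prod_def intro!: fmod.span_mono)

lemma power_mem_ideal_pow: "x \<in> I \<Longrightarrow> x ^ n \<in> ideal_pow I n"
  by (induction n) (auto simp: base_ring_closed ideal_prod_def intro!: fmod.span_base)

text \<open>Powers of ideals are tested on powers of elements, from which primality splits off one
  factor at a time.\<close>

lemma maximal_star_ideal_pow:
  assumes M: "maximal_star_ideal s M" and "I \<subseteq> base_ring" "ideal_pow I n \<subseteq> M"
  shows "I \<subseteq> M"
proof
  note D = proper_integral_star_idealD[OF maximal_star_idealD(1)[OF M]]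
  fix x assume x: "x \<in> I"
  have "x ^ k \<in> M \<Longrightarrow> x \<in> M" for k
  proof (induction k)
    \<comment> \<open>Exponent 0 would put 1 into \<open>M\<close>.\<close>
    case 0
    then show ?case using D(4) by simp
  next
    case (Suc k)
    have "x \<in> base_ring"
      using x assms(2) by blast
    moreover from this have "x ^ k \<in> base_ring"
      by (induction k) (auto intro: base_ring_closed)
    ultimately
    show ?case
      using Suc maximal_star_ideal_prime[OF M, of x "x ^ k"] by auto
  qed
  then show "x \<in> M"
    using power_mem_ideal_pow[OF x] assms(3) by blast
qed

lemma maximal_star_ideal_star_span:
  assumes "maximal_star_ideal s M" "X \<subseteq> M"
  shows "star s (fmod.span X) \<subseteq> M"
  using assms star_mono[OF fmod.span_minimal] proper_integral_star_idealD
    maximal_star_idealD(1) by metis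

section \<open>Members of f_*(D) and their generators\<close>

lemma f_starD:
  assumes "I \<in> f_star s"
  shows "proper_integral_star_ideal s I"
  using assms by (cases s) (auto simp: proper_integral_star_ideal_def star_ideal_def)

text \<open>Together with \<open>f_star_star_span\<close> this presents both cases of
  \<open>f_star\<close> as closures of finite generating sets; from there on d and t are treated
  alike.\<close>

lemma f_star_generators:
  assumes "I \<in> f_star s"
  obtains S where "finite S" "S \<subseteq> I" "\<not> S \<subseteq> {0}" "I = star s (fmod.span S)"
proof -
  have "\<exists>S. finite S \<and> nonzero_frac_ideal (fmod.span S) \<and> I = star s (fmod.span S)"
    using assms by (cases s) (auto simp: finite_type_def fin_gen_def)
  then obtain S where S: "finite S" "nonzero_frac_ideal (fmod.span S)" "I = star s (fmod.span S)"
    by blast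
  have "S \<subseteq> I"
    using S(3) star_superset[OF S(2)] fmod.span_superset by (metis order_trans)
  moreover have "\<not> S \<subseteq> {0}"
    using nonzero_frac_idealD(2)[OF S(2)] fmod.span_minimal[OF _ fmod.subspace_single_0]
    by metis
  ultimately show thesis
    using that S by blast
qed

text \<open>The maximal *-ideal around the generators contains their closure and so keeps it
  proper.\<close>

lemma f_star_star_span:
  assumes M: "maximal_star_ideal s M" and S: "finite S" "S \<subseteq> M" "\<not> S \<subseteq> {0}"
  shows "star s (fmod.span S) \<in> f_star s" "S \<subseteq> star s (fmod.span S)"
proof -
  note D = proper_integral_star_idealD[OF maximal_star_idealD(1)[OF M]]
  have base: "fmod.span S \<subseteq> base_ring"
    using S D(3) by (intro span_subset_base_ring) auto
  have nz: "nonzero_frac_ideal (fmod.span S)"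
    by (intro nonzero_frac_ideal_integral base span_nonzero[OF S(3)] fmod.subspace_span)
  have "1 \<notin> star s (fmod.span S)"
    using maximal_star_ideal_star_span[OF M S(2)] D(4) by blast
  then have "proper_integral_star_ideal s (star s (fmod.span S))"
    by (intro proper_integral_star_ideal_star base span_nonzero[OF S(3)] fmod.subspace_span)
  moreover have "fin_gen (fmod.span S)"
    using S(1) unfolding fin_gen_def by blast
  ultimately show "star s (fmod.span S) \<in> f_star s"
    using nz by (cases s)
      (auto simp: finite_type_def proper_integral_star_ideal_def star_ideal_def)
  show "S \<subseteq> star s (fmod.span S)"
    using star_superset[OF nz] fmod.span_superset by (metis order_trans)
qed

section \<open>Comaximality and maximal *-ideals\<close>

text \<open>A *-ideal containing \<open>A\<close> and \<open>B\<close> contains the closure of their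
  sum; conversely, if that closure misses 1, it lies in a maximal *-ideal.\<close>

lemma star_comaximal_iff:
  assumes A: "proper_integral_star_ideal s A" and B: "proper_integral_star_ideal s B"
  shows "star_comaximal s A B \<longleftrightarrow> \<not> (\<exists>M. maximal_star_ideal s M \<and> A \<subseteq> M \<and> B \<subseteq> M)"
proof -
  note DA = proper_integral_star_idealD[OF A] and DB = proper_integral_star_idealD[OF B]
  note sum = ideal_sum_subspace[OF DA(2) DB(2)]
  have base: "ideal_sum A B \<subseteq> base_ring"
    using sum(4) DA(3) DB(3) subspace_base_ring by blast
  have nz: "ideal_sum A B \<noteq> {0}"
    using sum(2) DA(6) by blast
  have frac: "nonzero_frac_ideal (ideal_sum A B)"
    using sum(1) base nz nonzero_frac_ideal_integral by blast
  show ?thesis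
  proof
    assume co: "star_comaximal s A B"
    show "\<not> (\<exists>M. maximal_star_ideal s M \<and> A \<subseteq> M \<and> B \<subseteq> M)"
    proof
      assume "\<exists>M. maximal_star_ideal s M \<and> A \<subseteq> M \<and> B \<subseteq> M"
      then obtain M where M: "maximal_star_ideal s M" "A \<subseteq> M" "B \<subseteq> M"
        by blast
      note D = proper_integral_star_idealD[OF maximal_star_idealD(1)[OF M(1)]]
      have "star s (ideal_sum A B) \<subseteq> M"
        using star_mono[OF sum(4)[OF M(2,3) D(2)]] D(5) by metis
      then show False
        using co D(4) base_ring_closed(2) unfolding star_comaximal_def by blast
    qed
  next
    assume no: "\<not> (\<exists>M. maximal_star_ideal s M \<and> A \<subseteq> M \<and> B \<subseteq> M)"
    have "1 \<in> star s (ideal_sum A B)"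
    proof (rule ccontr)
      assume "1 \<notin> star s (ideal_sum A B)"
      then have "proper_integral_star_ideal s (star s (ideal_sum A B))"
        using proper_integral_star_ideal_star sum(1) base nz by blast
      then obtain M where "maximal_star_ideal s M" "star s (ideal_sum A B) \<subseteq> M"
        using ex_maximal_star_ideal by blast
      then show False
        using no sum(2,3) star_superset[OF frac] by blast
    qed
    then show "star_comaximal s A B"
      unfolding star_comaximal_def
      using subspace_eq_base_ring[OF subspace_star[OF frac] star_subset_base_ring[OF base]]
      by blast
  qed
qed

text \<open>By finite character, 1 lies in the closure of finitely many sums from \<open>M\<close>
  and \<open>N\<close>. \<open>X\<close> and \<open>Y\<close> collect the summands; being finite,
  they can be adjoined to members of f_*(D).\<close>

lemma maximal_star_ideals_separated:
  assumes M: "maximal_star_ideal s M" and N: "maximal_star_ideal s N" and "M \<noteq> N"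
  obtains X Y where "finite X" "X \<subseteq> M" "finite Y" "Y \<subseteq> N"
    "\<And>L. maximal_star_ideal s L \<Longrightarrow> X \<subseteq> L \<Longrightarrow> Y \<subseteq> L \<Longrightarrow> False"
proof -
  note M' = maximal_star_idealD[OF M] and N' = maximal_star_idealD[OF N]
  note DM = proper_integral_star_idealD[OF M'(1)] and DN = proper_integral_star_idealD[OF N'(1)]
  note sum = ideal_sum_subspace[OF DM(2) DN(2)]
  \<comment> \<open>A maximal *-ideal above both would equal each of them.\<close>
  have "star_comaximal s M N"
    using star_comaximal_iff[OF M'(1) N'(1)] assms M'(2) N'(2) maximal_star_idealD(1) by metis
  then have "1 \<in> star s (ideal_sum M N)"
    by (simp add: star_comaximal_def base_ring_closed)
  moreover have "nonzero_frac_ideal (ideal_sum M N)"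
    using sum(1,2) sum(4)[OF DM(3) DN(3) subspace_base_ring] DM(6)
    by (intro nonzero_frac_ideal_integral) auto
  ultimately obtain S where S: "finite S" "S \<subseteq> ideal_sum M N" "1 \<in> star s (fmod.span S)"
    using star_finite_subset by metis
  have "\<forall>x\<in>S. \<exists>a b. a \<in> M \<and> b \<in> N \<and> x = a + b"
    using S(2) by (auto simp: ideal_sum_def dest!: subsetD)
  then obtain f g where fg: "\<And>x. x \<in> S \<Longrightarrow> f x \<in> M \<and> g x \<in> N \<and> x = f x + g x"
    by metis
  show thesis
  proof (rule that[of "f ` S" "g ` S"])
    show "finite (f ` S)" "f ` S \<subseteq> M" "finite (g ` S)" "g ` S \<subseteq> N"
      using S(1) fg by auto
    fix L assume L: "maximal_star_ideal s L" "f ` S \<subseteq> L" "g ` S \<subseteq> L"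
    note D = proper_integral_star_idealD[OF maximal_star_idealD(1)[OF L(1)]]
    have "S \<subseteq> L"
      using fg L(2,3) fmod.subspace_add[OF D(2)] by (metis image_subset_iff subsetI)
    then show False
      using maximal_star_ideal_star_span[OF L(1)] S(3) D(4) by blast
  qed
qed

text \<open>Adjoining \<open>X\<close> to the generators of \<open>J\<close> stays inside
  \<open>M\<close>, so the closure stays proper.\<close>

lemma f_star_enlarge:
  assumes "maximal_star_ideal s M" "J \<in> f_star s" "J \<subseteq> M" "finite X" "X \<subseteq> M"
  obtains A where "A \<in> f_star s" "J \<subseteq> A" "X \<subseteq> A"
proof -
  obtain S where S: "finite S" "S \<subseteq> J" "\<not> S \<subseteq> {0}" "J = star s (fmod.span S)"
    using f_star_generators[OF assms(2)] .
  let ?A = "star s (fmod.span (S \<union> X))"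
  have "finite (S \<union> X)" "S \<union> X \<subseteq> M" "\<not> S \<union> X \<subseteq> {0}"
    using assms S by blast+
  note f_star_star_span[OF assms(1) this]
  moreover have "J \<subseteq> ?A"
    unfolding S(4) by (intro star_mono fmod.span_mono) simp
  ultimately show thesis
    using that by auto
qed

section \<open>Consequences of the twisted condition\<close>

text \<open>Primality of maximal \<open>*\<close>-ideals lets comaximality pass from the \<open>A i\<close> to members of
  \<open>\<Gamma>\<close> containing powers of them.\<close>

lemma conrad_twisted_no_sequence:
  fixes P :: "'a::idom fract set \<Rightarrow> bool" and I :: "'a fract set"
  assumes F: "conrad_twisted s P" and lhd: "twisted_lhd s P" and I: "I \<in> f_star s"
    and A: "\<And>i::nat. A i \<in> f_star s" "\<And>i. I \<subseteq> A i"
  shows "\<exists>i j M. i \<noteq> j \<and> maximal_star_ideal s M \<and> A i \<subseteq> M \<and> A j \<subseteq> M"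
proof (rule ccontr)
  assume no: "\<not> ?thesis"
  have "\<forall>i. \<exists>n>0. \<exists>\<gamma>\<in>Gamma_set s P. ideal_pow (A i) n \<subseteq> \<gamma>"
    using lhd A(1) unfolding twisted_lhd_def by blast
  then obtain n \<gamma> where \<gamma>: "\<And>i. n i > 0" "\<And>i. \<gamma> i \<in> Gamma_set s P"
    "\<And>i. ideal_pow (A i) (n i) \<subseteq> \<gamma> i"
    by metis
  have proper: "proper_integral_star_ideal s (\<gamma> i)" for i
    using \<gamma>(2) f_starD unfolding Gamma_set_def by blast
  \<comment> \<open>\<open>I\<close> lies in every \<open>A i\<close>, so each power of an
    \<open>A i\<close> contains the same power of \<open>I\<close>; one \<open>I\<close> thus serves
    all terms.\<close>
  have "\<gamma> i \<in> Span s P I" for i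
    using \<gamma> ideal_pow_mono[OF A(2)] unfolding Span_def by blast
  moreover have "star_comaximal s (\<gamma> i) (\<gamma> j)" if "i \<noteq> j" for i j
  proof -
    have "A k \<subseteq> M" if "maximal_star_ideal s M" "\<gamma> k \<subseteq> M" for k M
      using maximal_star_ideal_pow[OF that(1) proper_integral_star_idealD(3)[OF f_starD[OF A(1)]]
          order_trans[OF \<gamma>(3) that(2)]] .
    then show ?thesis
      using no \<open>i \<noteq> j\<close> unfolding star_comaximal_iff[OF proper proper] by metis
  qed
  ultimately show False
    using F I unfolding conrad_twisted_def by metis
qed

text \<open>These are the *-homogeneous ideals of multiplicative ideal theory. \<open>M\<close> is
  an argument because the finiteness proof counts the maximal *-ideals that arise in this way; the
  set equation also says that \<open>M\<close> is maximal and contains \<open>H\<close>.\<close>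

definition homogeneous :: "star_op \<Rightarrow> 'a::idom fract set \<Rightarrow> 'a fract set \<Rightarrow> bool" where
  "homogeneous s M H \<longleftrightarrow> H \<in> f_star s \<and> {N. maximal_star_ideal s N \<and> H \<subseteq> N} = {M}"

text \<open>Otherwise every member of f_*(D) above \<open>J\<close> lies in two maximal *-ideals,
  and separating these splits it into two larger members with no common maximal *-ideal. Iteration
  contradicts \<open>conrad_twisted_no_sequence\<close>.\<close>

lemma conrad_twisted_ex_homogeneous:
  fixes P :: "'a::idom fract set \<Rightarrow> bool" and J :: "'a fract set"
  assumes F: "conrad_twisted s P" and lhd: "twisted_lhd s P"
    and J: "J \<in> f_star s"
  obtains H M where "homogeneous s M H" "J \<subseteq> H"
proof (rule ccontr)
  assume "\<not> thesis"
  define Q where "Q A \<longleftrightarrow> A \<in> f_star s \<and> J \<subseteq> A" for A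
  have no: "\<not> homogeneous s M A" if "Q A" for A M
    using that \<open>\<not> thesis\<close> Q_def \<open>\<And>M H. homogeneous s M H \<Longrightarrow> J \<subseteq> H \<Longrightarrow> thesis\<close> by blast
  have split: "\<exists>A' B'. Q A' \<and> Q B' \<and> B \<subseteq> A' \<and> B \<subseteq> B' \<and>
      (\<forall>M. maximal_star_ideal s M \<longrightarrow> A' \<subseteq> M \<longrightarrow> \<not> B' \<subseteq> M)" if "Q B" for B
  proof -
    have B: "B \<in> f_star s" "J \<subseteq> B"
      using that by (auto simp: Q_def)
    obtain M where M: "maximal_star_ideal s M" "B \<subseteq> M"
      using ex_maximal_star_ideal[OF f_starD[OF B(1)]] .
    have "{N. maximal_star_ideal s N \<and> B \<subseteq> N} \<noteq> {M}"
      using no[OF that, of M] B(1) by (simp add: homogeneous_def)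
    then obtain N where N: "maximal_star_ideal s N" "B \<subseteq> N" "M \<noteq> N"
      using M by blast
    obtain X Y where XY: "finite X" "X \<subseteq> M" "finite Y" "Y \<subseteq> N"
      "\<And>L. maximal_star_ideal s L \<Longrightarrow> X \<subseteq> L \<Longrightarrow> Y \<subseteq> L \<Longrightarrow> False"
      using maximal_star_ideals_separated[OF M(1) N(1,3)] by metis
    obtain A' where A': "A' \<in> f_star s" "B \<subseteq> A'" "X \<subseteq> A'"
      using f_star_enlarge[OF M(1) B(1) M(2) XY(1,2)] .
    obtain B' where B': "B' \<in> f_star s" "B \<subseteq> B'" "Y \<subseteq> B'"
      using f_star_enlarge[OF N(1) B(1) N(2) XY(3,4)] .
    show ?thesis
      using A' B' B XY(5) unfolding Q_def by (metis order_trans)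
  qed
  \<comment> \<open>Each \<open>f n\<close> is such a pair: its first half is kept for the sequence,
    its second half is split to give the next pair.\<close>
  have "\<exists>f. \<forall>n. (Q (fst (f n)) \<and> Q (snd (f n)) \<and>
        (\<forall>M. maximal_star_ideal s M \<longrightarrow> fst (f n) \<subseteq> M \<longrightarrow> \<not> snd (f n) \<subseteq> M)) \<and>
      (snd (f n) \<subseteq> fst (f (Suc n)) \<and> snd (f n) \<subseteq> snd (f (Suc n)))"
  proof (rule dependent_nat_choice, goal_cases)
    case 1
    show ?case using split[of J] J by (auto simp: Q_def)
  next
    case (2 x n)
    then show ?case using split[of "snd x"] by auto
  qed
  then obtain f where f: "\<And>n. Q (fst (f n))"
    "\<And>n M. maximal_star_ideal s M \<Longrightarrow> fst (f n) \<subseteq> M \<Longrightarrow> \<not> snd (f n) \<subseteq> M"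
    "\<And>n. snd (f n) \<subseteq> fst (f (Suc n))" "\<And>n. snd (f n) \<subseteq> snd (f (Suc n))"
    by blast
  have mono: "snd (f m) \<subseteq> fst (f n)" if less: "m < n" for m n
  proof -
    obtain k where k: "n = Suc k" "m \<le> k"
      using less by (cases n) auto
    then show ?thesis
      using lift_Suc_mono_le[of "\<lambda>i. snd (f i)", OF f(4) k(2)] f(3)[of k] by blast
  qed
  obtain i j M where ij: "i \<noteq> j" "maximal_star_ideal s M" "fst (f i) \<subseteq> M" "fst (f j) \<subseteq> M"
    using conrad_twisted_no_sequence[OF F lhd J, of "\<lambda>i. fst (f i)"] f(1)
    unfolding Q_def by blast
  \<comment> \<open>With \<open>i\<close> the smaller index, \<open>fst (f j)\<close> contains
    \<open>snd (f i)\<close>, so \<open>M\<close> would contain both halves of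
    \<open>f i\<close>.\<close>
  then show False
    using f(2) mono by (metis linorder_neqE_nat order_trans)
qed

lemma conrad_twisted_finite_hull:
  fixes P :: "'a::idom fract set \<Rightarrow> bool" and I :: "'a fract set"
  assumes F: "conrad_twisted s P" and lhd: "twisted_lhd s P" and I: "I \<in> f_star s"
  shows "finite {M. maximal_star_ideal s M \<and> I \<subseteq> M}"
proof (rule ccontr)
  assume inf: "infinite {M. maximal_star_ideal s M \<and> I \<subseteq> M}"
  define \<H> where "\<H> = {M. \<exists>H. homogeneous s M H \<and> I \<subseteq> H}"
  have max: "maximal_star_ideal s M" if "M \<in> \<H>" for M
    using that unfolding \<H>_def homogeneous_def by blast
  show False
  proof (cases "finite \<H>")
    case True
    then have "\<not> {M. maximal_star_ideal s M \<and> I \<subseteq> M} \<subseteq> \<H>"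
      using inf finite_subset by blast
    then obtain M where M: "maximal_star_ideal s M" "I \<subseteq> M" "M \<notin> \<H>"
      by blast
    \<comment> \<open>Distinct maximal *-ideals are incomparable.\<close>
    have "\<exists>a. a \<in> M \<and> a \<notin> N" if "N \<in> \<H>" for N
      using that M max maximal_star_idealD by (metis subsetI)
    then obtain a where a: "\<And>N. N \<in> \<H> \<Longrightarrow> a N \<in> M \<and> a N \<notin> N"
      by metis
    have "a ` \<H> \<subseteq> M"
      using a by blast
    \<comment> \<open>This \<open>J\<close> is contained in no member of \<open>\<H>\<close>, since
      it holds an element avoiding each of them.\<close>
    then obtain J where J: "J \<in> f_star s" "I \<subseteq> J" "a ` \<H> \<subseteq> J"
      using f_star_enlarge[OF M(1) I M(2) finite_imageI[OF True]] by blast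
    obtain H N where H: "homogeneous s N H" "J \<subseteq> H"
      using conrad_twisted_ex_homogeneous[OF F lhd J(1)] .
    have "N \<in> \<H>"
      using H J(2) unfolding \<H>_def by blast
    moreover have "H \<subseteq> N"
      using H(1) unfolding homogeneous_def by blast
    ultimately show False
      using a J(3) H(2) by blast
  next
    case False
    then obtain m :: "nat \<Rightarrow> 'a fract set" where m: "inj m" "range m \<subseteq> \<H>"
      using infinite_countable_subset by blast
    then have "\<forall>i. \<exists>H. homogeneous s (m i) H \<and> I \<subseteq> H"
      unfolding \<H>_def by blast
    then obtain A where A: "\<And>i. homogeneous s (m i) (A i)" "\<And>i. I \<subseteq> A i"
      by metis
    obtain i j M where ij: "i \<noteq> j" "maximal_star_ideal s M" "A i \<subseteq> M" "A j \<subseteq> M"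
      using conrad_twisted_no_sequence[OF F lhd I, of A] A unfolding homogeneous_def by blast
    then have "m i = M" "m j = M"
      using A(1) unfolding homogeneous_def by blast+
    then show False
      using ij(1) m(1) by (metis injD)
  qed
qed

section \<open>The converse\<close>

text \<open>The maximal *-ideals above the terms of a comaximal sequence in
  \<open>Span s P I\<close> are distinct and all contain \<open>I\<close>. A nonzero element of
  \<open>I\<close>, which is a non-unit of D, would then lie in infinitely many of them.\<close>

lemma finite_star_character_imp_conrad_twisted:
  fixes P :: "'a::idom fract set \<Rightarrow> bool"
  assumes fin: "finite_star_character s TYPE('a)"
  shows "conrad_twisted s P"
  unfolding conrad_twisted_def
proof (intro ballI notI, elim exE conjE)
  fix I :: "'a fract set" and \<gamma> :: "nat \<Rightarrow> 'a fract set"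
  assume I: "I \<in> f_star s" and span: "\<forall>i. \<gamma> i \<in> Span s P I"
    and co: "\<forall>i j. i \<noteq> j \<longrightarrow> star_comaximal s (\<gamma> i) (\<gamma> j)"
  note D = proper_integral_star_idealD[OF f_starD[OF I]]
  have proper: "proper_integral_star_ideal s (\<gamma> i)" for i
    using span f_starD unfolding Span_def Gamma_set_def by blast
  have "\<forall>i. \<exists>M. maximal_star_ideal s M \<and> \<gamma> i \<subseteq> M"
    using ex_maximal_star_ideal[OF proper] by metis
  then obtain m where m: "\<And>i. maximal_star_ideal s (m i)" "\<And>i. \<gamma> i \<subseteq> m i"
    by metis
  have "inj m"
    using co m unfolding star_comaximal_iff[OF proper proper] inj_def by metis
  have sub: "I \<subseteq> m i" for i
  proof -
    obtain n where "ideal_pow I n \<subseteq> \<gamma> i"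
      using span unfolding Span_def by blast
    then show ?thesis
      using m[of i] maximal_star_ideal_pow[OF m(1) D(3)] by blast
  qed
  \<comment> \<open>\<open>I\<close> is integral, so a nonzero element of it comes from D.\<close>
  obtain x where x: "to_fract x \<in> I" "x \<noteq> 0"
    using D(3,6) unfolding base_ring_def by (force simp: subset_iff)
  have "\<not> x dvd 1"
  proof
    assume "x dvd 1"
    then obtain y where "1 = x * y"
      by (rule dvdE)
    then have "to_fract y * to_fract x = 1"
      by (metis to_fract_1 to_fract_mult mult.commute)
    then show False
      using subspace_mult[OF D(2) base_ring_closed(3) x(1)] D(4) by metis
  qed
  then have "finite {M. maximal_star_ideal s M \<and> to_fract x \<in> M}"
    using fin x(2) unfolding finite_star_character_def by blast
  moreover have "range m \<subseteq> {M. maximal_star_ideal s M \<and> to_fract x \<in> M}"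
    using m(1) sub x(1) by blast
  ultimately show False
    using \<open>inj m\<close> finite_subset range_inj_infinite by blast
qed

theorem theorem4p8:
  fixes s :: star_op and P :: "'a::idom fract set \<Rightarrow> bool"
  assumes not_field: "\<exists>x::'a. x \<noteq> 0 \<and> \<not> x dvd 1"
    and nonempty: "Gamma_set s P \<noteq> {}"
    and lhd: "twisted_lhd s P"
  shows "(conrad_twisted s P \<longrightarrow>
            (\<forall>I\<in>(f_star s :: 'a fract set set). finite {M. maximal_star_ideal s M \<and> I \<subseteq> M}))
       \<and> (finite_star_character s TYPE('a) \<longrightarrow> conrad_twisted s P)"
  using conrad_twisted_finite_hull[OF _ lhd] finite_star_character_imp_conrad_twisted by blast

end
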